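(* Consider the implicitly constrained least-squares problem $\min_{u\in\mathbb{R}^n}\hat J(u)$, $\hat J(u)=\frac12\|\hat R(u)\|^2$, and the regularization method described in the context, with every subproblem solved exactly, i.e. $s_k$ is the exact minimizer of $s\mapsto m_k(u_k+s)$ for every $k$. Assume that: (1) $\hat J$ is continuously differentiable and $\nabla\hat J$ is $L$-Lipschitz continuous for some $L>0$; (2) there is $M_H>0$ such that $\|H_k\|\le M_H$ for all $k$; (3) $H_k$ is positive semidefinite for all $k$. For $\epsilon_g\in(0,1)$ and $\epsilon_R>0$, let $\mathcal{S}_{\epsilon_g,\epsilon_R}$ (resp. $\mathcal{U}_{\epsilon_g,\epsilon_R}$) be the set of successful (resp. unsuccessful) iterations $k$ for which $u_k$ does not satisfy $$\|\hat R(u_k)\|\le\epsilon_R\quad\text{or}\quad \frac{\|\hat G(u_k)^{\mathrm T}\hat R(u_k)\|}{\|\hat R(u_k)\|}\le\epsilon_g. \qquad ( * )$$ Then the number of successful iterations (and Jacobian evaluations) before reaching an iterate satisfying $( * )$ satisfies $$|\mathcal{S}_{\epsilon_g,\epsilon_R}|=\mathcal{O}\left(\log(\epsilon_R^{-1})\,\epsilon_g^{-2}\right),$$ and the total number of iterations (and residual evaluations) before reaching such an iterate satisfies $$|\mathcal{S}_{\epsilon_g,\epsilon_R}|+|\mathcal{U}_{\epsilon_g,\epsilon_R}|=\mathcal{O}\left(\log(\epsilon_R^{-1})\,\epsilon_g^{-2}\right).$$ Here $\mathcal{O}$ means: there exist constants $C>0$ and $\bar\epsilon\in(0,1)$, depending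 only on $L$, $M_H$, $\eta$, $\gamma_0$, $\gamma_{\min}$ and $\hat J(u_0)$, such that each of the quantities (including the corresponding evaluation counts) is at most $C\log(\epsilon_R^{-1})\epsilon_g^{-2}$ for all $\epsilon_g\in(0,1)$ and $\epsilon_R\in(0,\bar\epsilon]$.
   Context: Setting. $\|\cdot\|$ is the Euclidean norm for vectors and the spectral norm for matrices. $R:\mathbb{R}^{n_y}\times\mathbb{R}^n\to\mathbb{R}^m$ and $c:\mathbb{R}^{n_y}\times\mathbb{R}^n\to\mathbb{R}^p$ are given, and for each $u\in\mathbb{R}^n$ the equation $c(y,u)=0$ has a unique solution $y(u)$. Put $\hat R(u)=R(y(u),u)$, $\hat J(u)=\frac12\|\hat R(u)\|^2$, and let $\hat G(u)$ be the Jacobian of $\hat R$ at $u$, so that $\nabla\hat J(u)=\hat G(u)^{\mathrm T}\hat R(u)$. Method. Inputs: $u_0\in\mathbb{R}^n$, $\gamma_0>0$, $0<\gamma_{\min}\le\gamma_0$, $\eta\in(0,1)$. Compute $y(u_0)$, $R_0=\hat R(u_0)$, $G_0=\hat G(u_0)$. For $k=0,1,2,\dots$, with $R_k=\hat R(u_k)$, $G_k=\hat G(u_k)$, $g_k=G_k^{\mathrm T}R_k=\nabla\hat J(u_k)$ and $H_k\in\mathbb{R}^{n\times n}$ a symmetric matrix: compute a step $s_k$ by (approximately) minimizing over $s\in\mathbb{R}^n$ the model $$m_k(u_k+s)=\tfrac12\|R_k\|^2+g_k^{\mathrm T}s+\tfrac12 s^{\mathrm T}(H_k+\gamma_kI)s;$$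 compute $y(u_k+s_k)$ and the ratio $\rho_k=\dfrac{\hat J(u_k)-\hat J(u_k+s_k)}{m_k(u_k)-m_k(u_k+s_k)}$. If $\rho_k\ge\eta$, set $u_{k+1}=u_k+s_k$, $\gamma_{k+1}=\max\{0.5\gamma_k,\gamma_{\min}\}$ and evaluate $R_{k+1},G_{k+1}$; otherwise set $u_{k+1}=u_k$, $\gamma_{k+1}=2\gamma_k$. (If $g_k=0$, then $s_k=0$, the ratio is $0/0$, and $u_{k+1}=u_k$ regardless.) Iteration $k$ is successful if $u_{k+1}\ne u_k$ and unsuccessful otherwise. Cost counts: the Jacobian $\hat G$ is evaluated once at $u_0$ and once after each successful iteration; the residual $\hat R$ is evaluated once at $u_0$ and once per iteration at the trial point $u_k+s_k$. When $\hat R(u_k)=0$ the first alternative of $( * )$ holds, so the quotient is only considered for $\hat R(u_k)\neq 0$. *)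

theory Defs
  imports "Jordan_Normal_Form.Matrix" Complex_Main
begin

(* The constants hidden in the O-notation must not depend on the dimensions, so the dimensions have
   to be quantified inside the statement.  R^n is therefore "carrier_vec n" rather than a
   type "real ^ 'n", and the Euclidean norm, the spectral norm and the Frechet derivative are
   written out for these carriers. *)

definition vnorm :: "real vec \<Rightarrow> real" where
  "vnorm v = sqrt (v \<bullet> v)"

(* The spectral norm as the operator norm induced by the Euclidean norm. *)
definition spectral_norm :: "real mat \<Rightarrow> real" where
  "spectral_norm A = (SUP x \<in> {x \<in> carrier_vec (dim_col A). vnorm x \<le> 1}. vnorm (A *\<^sub>v x))"

definition has_jacobian :: "nat \<Rightarrow> nat \<Rightarrow> (real vec \<Rightarrow> real vec) \<Rightarrow> real vec \<Rightarrow> real mat \<Rightarrow> bool" where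
  "has_jacobian n m F v A \<longleftrightarrow>
     A \<in> carrier_mat m n \<and>
     (\<forall>\<epsilon>>0. \<exists>\<delta>>0. \<forall>h \<in> carrier_vec n.
        vnorm h < \<delta> \<longrightarrow> vnorm (F (v + h) - F v - A *\<^sub>v h) \<le> \<epsilon> * vnorm h)"

definition has_gradient :: "nat \<Rightarrow> (real vec \<Rightarrow> real) \<Rightarrow> real vec \<Rightarrow> real vec \<Rightarrow> bool" where
  "has_gradient n f v g \<longleftrightarrow>
     g \<in> carrier_vec n \<and>
     (\<forall>\<epsilon>>0. \<exists>\<delta>>0. \<forall>h \<in> carrier_vec n.
        vnorm h < \<delta> \<longrightarrow> \<bar>f (v + h) - f v - g \<bullet> h\<bar> \<le> \<epsilon> * vnorm h)"

definition vcontinuous :: "nat \<Rightarrow> (real vec \<Rightarrow> real vec) \<Rightarrow> bool" where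
  "vcontinuous n F \<longleftrightarrow>
     (\<forall>v \<in> carrier_vec n. \<forall>\<epsilon>>0. \<exists>\<delta>>0. \<forall>w \<in> carrier_vec n.
        vnorm (w - v) < \<delta> \<longrightarrow> vnorm (F w - F v) < \<epsilon>)"

definition vlipschitz :: "real \<Rightarrow> nat \<Rightarrow> (real vec \<Rightarrow> real vec) \<Rightarrow> bool" where
  "vlipschitz L n F \<longleftrightarrow>
     (\<forall>v \<in> carrier_vec n. \<forall>w \<in> carrier_vec n. vnorm (F v - F w) \<le> L * vnorm (v - w))"

definition C1_lipschitz_gradient :: "real \<Rightarrow> nat \<Rightarrow> (real vec \<Rightarrow> real) \<Rightarrow> bool" where
  "C1_lipschitz_gradient L n f \<longleftrightarrow>
     (\<exists>grad. (\<forall>v \<in> carrier_vec n. has_gradient n f v (grad v)) \<and>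
             vcontinuous n grad \<and> vlipschitz L n grad)"

definition pos_semidef :: "nat \<Rightarrow> real mat \<Rightarrow> bool" where
  "pos_semidef n A \<longleftrightarrow> (\<forall>x \<in> carrier_vec n. 0 \<le> x \<bullet> (A *\<^sub>v x))"

definition implicit_problem ::
  "nat \<Rightarrow> nat \<Rightarrow> nat \<Rightarrow> nat \<Rightarrow> (real vec \<Rightarrow> real vec \<Rightarrow> real vec) \<Rightarrow> (real vec \<Rightarrow> real vec \<Rightarrow> real vec) \<Rightarrow> bool"
where
  "implicit_problem ny n m p R c \<longleftrightarrow>
     (\<forall>y \<in> carrier_vec ny. \<forall>v \<in> carrier_vec n. R y v \<in> carrier_vec m \<and> c y v \<in> carrier_vec p) \<and>
     (\<forall>v \<in> carrier_vec n. \<exists>!y. y \<in> carrier_vec ny \<and> c y v = 0\<^sub>v p)"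

definition implicit_sol :: "nat \<Rightarrow> nat \<Rightarrow> (real vec \<Rightarrow> real vec \<Rightarrow> real vec) \<Rightarrow> real vec \<Rightarrow> real vec" where
  "implicit_sol ny p c v = (THE y. y \<in> carrier_vec ny \<and> c y v = 0\<^sub>v p)"

definition reduced_residual ::
  "nat \<Rightarrow> nat \<Rightarrow> (real vec \<Rightarrow> real vec \<Rightarrow> real vec) \<Rightarrow> (real vec \<Rightarrow> real vec \<Rightarrow> real vec) \<Rightarrow> real vec \<Rightarrow> real vec"
where
  "reduced_residual ny p R c v = R (implicit_sol ny p c v) v"

definition objective :: "(real vec \<Rightarrow> real vec) \<Rightarrow> real vec \<Rightarrow> real" where
  "objective Rh v = 1 / 2 * (vnorm (Rh v))\<^sup>2"

(* Rh is the reduced residual, G its Jacobian. *)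
definition grad_vec :: "(real vec \<Rightarrow> real vec) \<Rightarrow> (real vec \<Rightarrow> real mat) \<Rightarrow> real vec \<Rightarrow> real vec" where
  "grad_vec Rh G v = transpose_mat (G v) *\<^sub>v Rh v"

(* The value m_k(u_k + s), as a function of the step s; here v = u_k, B = H_k and \<gamma> = \<gamma>_k. *)
definition reg_model ::
  "nat \<Rightarrow> (real vec \<Rightarrow> real vec) \<Rightarrow> (real vec \<Rightarrow> real mat) \<Rightarrow> real vec \<Rightarrow> real mat \<Rightarrow> real \<Rightarrow> real vec \<Rightarrow> real"
where
  "reg_model n Rh G v B \<gamma> s =
     1 / 2 * (vnorm (Rh v))\<^sup>2 + grad_vec Rh G v \<bullet> s
       + 1 / 2 * (s \<bullet> ((B + \<gamma> \<cdot>\<^sub>m 1\<^sub>m n) *\<^sub>v s))"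

definition decrease_ratio ::
  "nat \<Rightarrow> (real vec \<Rightarrow> real vec) \<Rightarrow> (real vec \<Rightarrow> real mat) \<Rightarrow> real vec \<Rightarrow> real mat \<Rightarrow> real \<Rightarrow> real vec \<Rightarrow> real"
where
  "decrease_ratio n Rh G v B \<gamma> s =
     (objective Rh v - objective Rh (v + s))
       / (reg_model n Rh G v B \<gamma> (0\<^sub>v n) - reg_model n Rh G v B \<gamma> s)"

(* A run of the method with steps s_k that are still unrestricted.  If g_k = 0, the ratio is 0/0;
   then u_{k+1} = u_k, and either of the two updates of \<gamma>_k is admitted. *)
definition regularization_run ::
  "nat \<Rightarrow> (real vec \<Rightarrow> real vec) \<Rightarrow> (real vec \<Rightarrow> real mat) \<Rightarrow> real \<Rightarrow> real \<Rightarrow> real \<Rightarrow>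
   (nat \<Rightarrow> real mat) \<Rightarrow> (nat \<Rightarrow> real vec) \<Rightarrow> (nat \<Rightarrow> real vec) \<Rightarrow> (nat \<Rightarrow> real) \<Rightarrow> bool"
where
  "regularization_run n Rh G \<eta> \<gamma>0 \<gamma>min H u s \<gamma> \<longleftrightarrow>
     u 0 \<in> carrier_vec n \<and> \<gamma> 0 = \<gamma>0 \<and>
     (\<forall>k. H k \<in> carrier_mat n n \<and> transpose_mat (H k) = H k \<and> s k \<in> carrier_vec n \<and>
        (if grad_vec Rh G (u k) = 0\<^sub>v n then
           u (Suc k) = u k \<and> \<gamma> (Suc k) \<in> {max (0.5 * \<gamma> k) \<gamma>min, 2 * \<gamma> k}
         else if decrease_ratio n Rh G (u k) (H k) (\<gamma> k) (s k) \<ge> \<eta> then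
           u (Suc k) = u k + s k \<and> \<gamma> (Suc k) = max (0.5 * \<gamma> k) \<gamma>min
         else
           u (Suc k) = u k \<and> \<gamma> (Suc k) = 2 * \<gamma> k))"

definition exact_steps ::
  "nat \<Rightarrow> (real vec \<Rightarrow> real vec) \<Rightarrow> (real vec \<Rightarrow> real mat) \<Rightarrow>
   (nat \<Rightarrow> real mat) \<Rightarrow> (nat \<Rightarrow> real vec) \<Rightarrow> (nat \<Rightarrow> real vec) \<Rightarrow> (nat \<Rightarrow> real) \<Rightarrow> bool"
where
  "exact_steps n Rh G H u s \<gamma> \<longleftrightarrow>
     (\<forall>k. is_arg_min (reg_model n Rh G (u k) (H k) (\<gamma> k)) (\<lambda>x. x \<in> carrier_vec n) (s k))"

(* For Rh v = 0 the first alternative holds because \<epsilon>R > 0, so the quotient x / 0 is harmless. *)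
definition approx_solution ::
  "(real vec \<Rightarrow> real vec) \<Rightarrow> (real vec \<Rightarrow> real mat) \<Rightarrow> real \<Rightarrow> real \<Rightarrow> real vec \<Rightarrow> bool"
where
  "approx_solution Rh G \<epsilon>g \<epsilon>R v \<longleftrightarrow>
     vnorm (Rh v) \<le> \<epsilon>R \<or> vnorm (transpose_mat (G v) *\<^sub>v Rh v) / vnorm (Rh v) \<le> \<epsilon>g"

definition succ_iters ::
  "(real vec \<Rightarrow> real vec) \<Rightarrow> (real vec \<Rightarrow> real mat) \<Rightarrow> (nat \<Rightarrow> real vec) \<Rightarrow> real \<Rightarrow> real \<Rightarrow> nat set"
where
  "succ_iters Rh G u \<epsilon>g \<epsilon>R = {k. u (Suc k) \<noteq> u k \<and> \<not> approx_solution Rh G \<epsilon>g \<epsilon>R (u k)}"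

definition unsucc_iters ::
  "(real vec \<Rightarrow> real vec) \<Rightarrow> (real vec \<Rightarrow> real mat) \<Rightarrow> (nat \<Rightarrow> real vec) \<Rightarrow> real \<Rightarrow> real \<Rightarrow> nat set"
where
  "unsucc_iters Rh G u \<epsilon>g \<epsilon>R = {k. u (Suc k) = u k \<and> \<not> approx_solution Rh G \<epsilon>g \<epsilon>R (u k)}"

(* One evaluation at u_0, and one after each successful iteration. *)
definition jacobian_evals ::
  "(real vec \<Rightarrow> real vec) \<Rightarrow> (real vec \<Rightarrow> real mat) \<Rightarrow> (nat \<Rightarrow> real vec) \<Rightarrow> real \<Rightarrow> real \<Rightarrow> nat"
where
  "jacobian_evals Rh G u \<epsilon>g \<epsilon>R = 1 + card (succ_iters Rh G u \<epsilon>g \<epsilon>R)"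

(* One evaluation at u_0, and one per iteration, at the trial point. *)
definition residual_evals ::
  "(real vec \<Rightarrow> real vec) \<Rightarrow> (real vec \<Rightarrow> real mat) \<Rightarrow> (nat \<Rightarrow> real vec) \<Rightarrow> real \<Rightarrow> real \<Rightarrow> nat"
where
  "residual_evals Rh G u \<epsilon>g \<epsilon>R =
     1 + (card (succ_iters Rh G u \<epsilon>g \<epsilon>R) + card (unsucc_iters Rh G u \<epsilon>g \<epsilon>R))"

end

theory Submission
  imports Defs
begin

text \<open>
  Write \<open>J = \<parallel>R\<parallel>\<^sup>2 / 2\<close> for the objective, \<open>g\<close> for its gradient, and \<open>M\<close> for the bound on
  the matrices \<open>H\<close>.  Two observations carry the proof.

  The parameter \<open>\<gamma>\<close> stays bounded.  The exact step \<open>s\<close> satisfies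
  \<open>g \<bullet> s = - s \<bullet> (H + \<gamma> I) s\<close>, so its predicted decrease equals \<open>- (g \<bullet> s) / 2\<close> and, \<open>H\<close> being
  positive semidefinite, is at least \<open>\<gamma> \<parallel>s\<parallel>\<^sup>2 / 2\<close>.  For \<open>\<gamma> \<ge> L\<close> the descent inequality then makes
  the actual decrease no smaller than the predicted one, and the step is accepted
  (\<open>accepted_if_\<gamma>_ge_L\<close>).  Hence \<open>\<gamma> \<le> max \<gamma>0 (2 L)\<close> as long as \<open>g \<noteq> 0\<close> (\<open>\<gamma>_le_max\<close>).

  The objective contracts.  Comparison with a steepest descent step bounds the predicted
  decrease below by \<open>\<parallel>g\<parallel>\<^sup>2 / (2 (M + \<gamma>))\<close>.  Where the stopping test fails,
  \<open>\<parallel>g\<parallel> > \<epsilon>g \<parallel>R\<parallel>\<close>, hence \<open>\<parallel>g\<parallel>\<^sup>2 > 2 \<epsilon>g\<^sup>2 J\<close>, and a successful iteration multiplies \<open>J\<close> by at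
  most \<open>1 - \<kappa> \<epsilon>g\<^sup>2\<close> with \<open>\<kappa> = \<eta> / (M + max \<gamma>0 (2 L))\<close> (\<open>successful_contraction\<close>).  Since \<open>J\<close> never
  increases and exceeds \<open>\<epsilon>R\<^sup>2 / 2\<close> where the test fails, at most about
  \<open>ln (2 J0 / \<epsilon>R\<^sup>2) / (\<kappa> \<epsilon>g\<^sup>2)\<close> such iterations exist (\<open>card_contractions_le\<close>).

  Counted over the whole run, the iterates that fail the test need not form an initial
  segment, because the quotient \<open>\<parallel>g\<parallel> / \<parallel>R\<parallel>\<close> can grow again.  So the unsuccessful iterations are
  not estimated by following \<open>\<gamma>\<close> from the start.  Instead, an unsuccessful iteration keeps the
  iterate, hence also the failure of the test, and doubles \<open>\<gamma>\<close>; as \<open>\<gamma>min \<le> \<gamma>\<close> throughout and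
  \<open>\<gamma> \<ge> L\<close> forces success, one of the next \<open>Q\<close> iterations is a counted success, where
  \<open>L \<le> 2 ^ Q * \<gamma>min\<close> (\<open>card_doublings_le\<close>).
\<close>

section \<open>Euclidean norm and spectral norm on carriers\<close>

lemma vnorm_nonneg [simp]: "0 \<le> vnorm v"
  by (simp add: vnorm_def scalar_prod_def sum_nonneg)

lemma vnorm_square: "(vnorm v)\<^sup>2 = v \<bullet> v"
  by (simp add: vnorm_def scalar_prod_def sum_nonneg)

lemma vnorm_square_sum: "v \<in> carrier_vec n \<Longrightarrow> (vnorm v)\<^sup>2 = (\<Sum>i<n. (v $ i)\<^sup>2)"
  unfolding vnorm_square by (auto simp: scalar_prod_def power2_eq_square atLeast0LessThan)

lemma abs_index_le_vnorm:
  assumes "v \<in> carrier_vec n" and "i < n"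
  shows "\<bar>v $ i\<bar> \<le> vnorm v"
proof -
  have "(v $ i)\<^sup>2 \<le> (\<Sum>i<n. (v $ i)\<^sup>2)"
    by (rule member_le_sum) (use assms in auto)
  then have "\<bar>v $ i\<bar>\<^sup>2 \<le> (vnorm v)\<^sup>2"
    using vnorm_square_sum[OF assms(1)] by simp
  then show ?thesis
    by (rule power2_le_imp_le) simp
qed

lemma vnorm_eq_0_iff:
  assumes "v \<in> carrier_vec n"
  shows "vnorm v = 0 \<longleftrightarrow> v = 0\<^sub>v n"
proof
  assume "vnorm v = 0"
  then have "\<And>i. i < n \<Longrightarrow> v $ i = 0"
    using abs_index_le_vnorm[OF assms] by fastforce
  then show "v = 0\<^sub>v n"
    using assms by (intro eq_vecI) auto
qed (simp add: vnorm_def)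

lemma vnorm_smult: "vnorm (a \<cdot>\<^sub>v v) = \<bar>a\<bar> * vnorm v"
proof -
  have "(vnorm (a \<cdot>\<^sub>v v))\<^sup>2 = (\<bar>a\<bar> * vnorm v)\<^sup>2"
    by (simp add: vnorm_square power_mult_distrib power2_eq_square[of a])
  then show ?thesis
    by (simp add: power2_eq_iff_nonneg)
qed

text \<open>
  Expanding \<open>\<parallel>\<parallel>w\<parallel> v - \<parallel>v\<parallel> w\<parallel>\<^sup>2 \<ge> 0\<close> gives the inequality multiplied by \<open>\<parallel>v\<parallel> \<parallel>w\<parallel>\<close>.
\<close>

lemma vnorm_Cauchy_Schwarz:
  assumes "v \<in> carrier_vec n" and "w \<in> carrier_vec n"
  shows "\<bar>v \<bullet> w\<bar> \<le> vnorm v * vnorm w"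
proof -
  have key: "2 * (vnorm v * vnorm w) * (v \<bullet> w) \<le> 2 * ((vnorm v)\<^sup>2 * (vnorm w)\<^sup>2)"
    if v: "v \<in> carrier_vec n" and w: "w \<in> carrier_vec n" for v w
  proof -
    have "0 \<le> (vnorm (vnorm w \<cdot>\<^sub>v v - vnorm v \<cdot>\<^sub>v w))\<^sup>2"
      by simp
    also have "\<dots> = 2 * ((vnorm v)\<^sup>2 * (vnorm w)\<^sup>2) - 2 * (vnorm v * vnorm w) * (v \<bullet> w)"
      using v w comm_scalar_prod[OF v w]
      by (simp add: vnorm_square minus_scalar_prod_distrib[of _ n] scalar_prod_minus_distrib[of _ n]
          algebra_simps)
        (simp add: vnorm_square[symmetric] power2_eq_square algebra_simps)
    finally show ?thesis
      by simp
  qed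
  have le: "v \<bullet> w \<le> vnorm v * vnorm w" if v: "v \<in> carrier_vec n" and w: "w \<in> carrier_vec n" for v w
  proof (cases "vnorm v * vnorm w = 0")
    case True
    then have "v = 0\<^sub>v n \<or> w = 0\<^sub>v n"
      using v w by (simp add: vnorm_eq_0_iff)
    then show ?thesis
      using v w by auto
  next
    case False
    then have "0 < vnorm v * vnorm w"
      by (simp add: less_le)
    moreover have "(vnorm v * vnorm w) * (v \<bullet> w) \<le> (vnorm v * vnorm w) * (vnorm v * vnorm w)"
      using key[OF v w] by (simp add: power2_eq_square algebra_simps)
    ultimately show ?thesis
      using mult_le_cancel_left_pos by blast
  qed
  have "- (v \<bullet> w) \<le> vnorm v * vnorm w"
    using le[of "(-1) \<cdot>\<^sub>v v" w] assms by (simp add: vnorm_smult)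
  with le[OF assms] show ?thesis
    by linarith
qed

text \<open>
  The spectral norm is a supremum of reals, hence meaningful only once the set is known to be
  bounded; the Frobenius norm provides a bound.
\<close>

lemma bdd_above_unit_ball_image:
  assumes A: "A \<in> carrier_mat m n"
  shows "bdd_above ((\<lambda>x. vnorm (A *\<^sub>v x)) ` {x \<in> carrier_vec n. vnorm x \<le> 1})"
proof (rule bdd_aboveI2)
  fix x :: "real vec"
  assume "x \<in> {x \<in> carrier_vec n. vnorm x \<le> 1}"
  then have x: "x \<in> carrier_vec n" and x1: "vnorm x \<le> 1"
    by auto
  have "(vnorm (A *\<^sub>v x))\<^sup>2 = (\<Sum>i<m. (row A i \<bullet> x)\<^sup>2)"
    using A x by (subst vnorm_square_sum[of _ m]) auto
  also have "\<dots> \<le> (\<Sum>i<m. (vnorm (row A i))\<^sup>2)"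
  proof (rule sum_mono)
    fix i
    assume "i \<in> {..<m}"
    then have "row A i \<in> carrier_vec n"
      using A by auto
    then have "\<bar>row A i \<bullet> x\<bar> \<le> vnorm (row A i) * vnorm x"
      using x by (rule vnorm_Cauchy_Schwarz)
    also have "\<dots> \<le> vnorm (row A i)"
      using x1 by (simp add: mult_left_le)
    finally show "(row A i \<bullet> x)\<^sup>2 \<le> (vnorm (row A i))\<^sup>2"
      using abs_le_square_iff by fastforce
  qed
  finally show "vnorm (A *\<^sub>v x) \<le> sqrt (\<Sum>i<m. (vnorm (row A i))\<^sup>2)"
    by (rule real_le_rsqrt)
qed

lemma vnorm_mult_mat_vec_le:
  assumes A: "A \<in> carrier_mat m n" and x: "x \<in> carrier_vec n"
  shows "vnorm (A *\<^sub>v x) \<le> spectral_norm A * vnorm x"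
proof (cases "vnorm x = 0")
  case True
  then have x0: "x = 0\<^sub>v n"
    using x by (simp add: vnorm_eq_0_iff)
  have "A *\<^sub>v x = 0\<^sub>v m"
    unfolding x0 using A by (intro eq_vecI) auto
  with True show ?thesis
    by (simp add: vnorm_def)
next
  case False
  then have pos: "0 < vnorm x"
    by (simp add: less_le)
  define y where "y = (1 / vnorm x) \<cdot>\<^sub>v x"
  have "y \<in> {x \<in> carrier_vec n. vnorm x \<le> 1}"
    using x pos by (simp add: y_def vnorm_smult)
  then have "vnorm (A *\<^sub>v y) \<le> spectral_norm A"
    unfolding spectral_norm_def using A bdd_above_unit_ball_image[OF A]
    by (intro cSUP_upper) auto
  moreover have "vnorm (A *\<^sub>v y) = vnorm (A *\<^sub>v x) / vnorm x"
    using A x pos by (simp add: y_def mult_mat_vec[OF A x] vnorm_smult)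
  ultimately show ?thesis
    using pos by (simp add: field_simps)
qed

lemma spectral_norm_quadratic_bound:
  assumes A: "A \<in> carrier_mat n n" and x: "x \<in> carrier_vec n"
  shows "x \<bullet> (A *\<^sub>v x) \<le> spectral_norm A * (vnorm x)\<^sup>2"
proof -
  have "x \<bullet> (A *\<^sub>v x) \<le> vnorm x * vnorm (A *\<^sub>v x)"
    using vnorm_Cauchy_Schwarz[OF x, of "A *\<^sub>v x"] A x by auto
  also have "\<dots> \<le> vnorm x * (spectral_norm A * vnorm x)"
    using vnorm_mult_mat_vec_le[OF A x] by (simp add: mult_left_mono)
  finally show ?thesis
    by (simp add: power2_eq_square algebra_simps)
qed

section \<open>Gradients, derivatives along rays, and the descent inequality\<close>

text \<open>
  Restriction to rays reduces the vector statements below to calculus of one real variable.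
\<close>

lemma has_gradient_ray_derivative:
  assumes f: "has_gradient n f (v + t \<cdot>\<^sub>v h) g"
    and v: "v \<in> carrier_vec n" and h: "h \<in> carrier_vec n"
  shows "((\<lambda>t. f (v + t \<cdot>\<^sub>v h)) has_real_derivative g \<bullet> h) (at t)"
  unfolding DERIV_def LIM_eq
proof (intro allI impI)
  fix r :: real
  assume r: "0 < r"
  \<comment> \<open>The summand 1 keeps the denominator positive when \<open>h = 0\<close>.\<close>
  define \<epsilon> where "\<epsilon> = r / (2 * (vnorm h + 1))"
  have hp: "0 < vnorm h + 1"
    by (simp add: add_nonneg_pos)
  have e: "0 < \<epsilon>"
    using r hp by (simp add: \<epsilon>_def)
  obtain d where d: "0 < d"
    and fd: "\<And>k. k \<in> carrier_vec n \<Longrightarrow> vnorm k < d \<Longrightarrow>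
      \<bar>f (v + t \<cdot>\<^sub>v h + k) - f (v + t \<cdot>\<^sub>v h) - g \<bullet> k\<bar> \<le> \<epsilon> * vnorm k"
    using f e unfolding has_gradient_def by blast
  have g: "g \<in> carrier_vec n"
    using f by (simp add: has_gradient_def)
  show "\<exists>s>0. \<forall>x. x \<noteq> 0 \<and> norm (x - 0) < s \<longrightarrow>
      norm ((f (v + (t + x) \<cdot>\<^sub>v h) - f (v + t \<cdot>\<^sub>v h)) / x - g \<bullet> h) < r"
  proof (intro exI[of _ "d / (vnorm h + 1)"] conjI allI impI)
    show "0 < d / (vnorm h + 1)"
      using d hp by simp
    fix x :: real
    assume x: "x \<noteq> 0 \<and> norm (x - 0) < d / (vnorm h + 1)"
    have "vnorm (x \<cdot>\<^sub>v h) \<le> \<bar>x\<bar> * (vnorm h + 1)"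
      by (simp add: vnorm_smult mult_left_mono)
    also have "\<dots> < d"
      using x hp by (simp add: pos_less_divide_eq)
    finally have small: "vnorm (x \<cdot>\<^sub>v h) < d" .
    have eq: "v + t \<cdot>\<^sub>v h + x \<cdot>\<^sub>v h = v + (t + x) \<cdot>\<^sub>v h"
      using v h by (intro eq_vecI) (auto simp: algebra_simps)
    have "\<bar>f (v + (t + x) \<cdot>\<^sub>v h) - f (v + t \<cdot>\<^sub>v h) - x * (g \<bullet> h)\<bar> \<le> \<epsilon> * (\<bar>x\<bar> * vnorm h)"
      using fd[of "x \<cdot>\<^sub>v h"] small h g by (simp add: eq vnorm_smult)
    moreover have "(f (v + (t + x) \<cdot>\<^sub>v h) - f (v + t \<cdot>\<^sub>v h)) / x - g \<bullet> h
        = (f (v + (t + x) \<cdot>\<^sub>v h) - f (v + t \<cdot>\<^sub>v h) - x * (g \<bullet> h)) / x"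
      using x by (simp add: field_simps)
    ultimately have "norm ((f (v + (t + x) \<cdot>\<^sub>v h) - f (v + t \<cdot>\<^sub>v h)) / x - g \<bullet> h) \<le> \<epsilon> * vnorm h"
      using x by (simp add: abs_divide pos_divide_le_eq mult_ac)
    also have "\<dots> \<le> \<epsilon> * (vnorm h + 1)"
      using e by (simp add: mult_left_mono)
    also have "\<dots> = r / 2"
      using hp unfolding \<epsilon>_def by (simp only: times_divide_eq_left) (simp add: field_simps)
    also have "\<dots> < r"
      using r by simp
    finally show "norm ((f (v + (t + x) \<cdot>\<^sub>v h) - f (v + t \<cdot>\<^sub>v h)) / x - g \<bullet> h) < r" .
  qed
qed

lemma has_jacobian_component_gradient:
  assumes J: "has_jacobian n m F v A" and i: "i < m" and v: "v \<in> carrier_vec n"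
    and F: "\<And>w. w \<in> carrier_vec n \<Longrightarrow> F w \<in> carrier_vec m"
  shows "has_gradient n (\<lambda>w. F w $ i) v (row A i)"
  unfolding has_gradient_def
proof (intro conjI allI impI)
  have A: "A \<in> carrier_mat m n"
    using J by (simp add: has_jacobian_def)
  then show "row A i \<in> carrier_vec n"
    using i by auto
  fix \<epsilon> :: real
  assume "0 < \<epsilon>"
  then obtain d where d: "0 < d"
    and Fd: "\<And>h. h \<in> carrier_vec n \<Longrightarrow> vnorm h < d \<Longrightarrow>
      vnorm (F (v + h) - F v - A *\<^sub>v h) \<le> \<epsilon> * vnorm h"
    using J unfolding has_jacobian_def by blast
  have "\<bar>F (v + h) $ i - F v $ i - row A i \<bullet> h\<bar> \<le> \<epsilon> * vnorm h"
    if h: "h \<in> carrier_vec n" and hd: "vnorm h < d" for h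
  proof -
    have c: "F (v + h) - F v - A *\<^sub>v h \<in> carrier_vec m"
      using A F[of v] F[of "v + h"] v h by auto
    have "(F (v + h) - F v - A *\<^sub>v h) $ i = F (v + h) $ i - F v $ i - row A i \<bullet> h"
      using A F[of v] F[of "v + h"] v h i by auto
    then show ?thesis
      using abs_index_le_vnorm[OF c i] Fd[OF h hd] by simp
  qed
  with d show "\<exists>\<delta>>0. \<forall>h\<in>carrier_vec n. vnorm h < \<delta> \<longrightarrow>
      \<bar>F (v + h) $ i - F v $ i - row A i \<bullet> h\<bar> \<le> \<epsilon> * vnorm h"
    by blast
qed

text \<open>
  The Lipschitz hypothesis speaks of some gradient of the objective, the method of
  \<open>G\<^sup>T R\<close>.  Both give the derivative of the objective along every ray, the
  second by the chain rule, so they agree.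
\<close>

lemma objective_gradient_unique:
  assumes grad: "has_gradient n (objective F) v g" and J: "has_jacobian n m F v (G v)"
    and v: "v \<in> carrier_vec n" and F: "\<And>w. w \<in> carrier_vec n \<Longrightarrow> F w \<in> carrier_vec m"
  shows "g = grad_vec F G v"
proof -
  have A: "G v \<in> carrier_mat m n"
    using J by (simp add: has_jacobian_def)
  have g: "g \<in> carrier_vec n"
    using grad by (simp add: has_gradient_def)
  have gv: "grad_vec F G v \<in> carrier_vec n"
    using A F[OF v] unfolding grad_vec_def by (metis mult_mat_vec_carrier transpose_carrier_mat)
  have "g \<bullet> h = grad_vec F G v \<bullet> h" if h: "h \<in> carrier_vec n" for h
  proof -
    have v0: "v + 0 \<cdot>\<^sub>v h = v"
      using v h by (intro eq_vecI) auto
    have D1: "((\<lambda>t. objective F (v + t \<cdot>\<^sub>v h)) has_real_derivative g \<bullet> h) (at 0)"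
      using has_gradient_ray_derivative[of n "objective F" v 0 h g] grad v h by (simp add: v0)
    have comp: "((\<lambda>t. F (v + t \<cdot>\<^sub>v h) $ i) has_real_derivative row (G v) i \<bullet> h) (at 0)" if "i < m" for i
      using has_gradient_ray_derivative[of n "\<lambda>w. F w $ i" v 0 h "row (G v) i"] v h
        has_jacobian_component_gradient[OF J that v F] by (simp add: v0)
    have obj: "(\<lambda>t. objective F (v + t \<cdot>\<^sub>v h)) = (\<lambda>t. 1 / 2 * (\<Sum>i<m. (F (v + t \<cdot>\<^sub>v h) $ i)\<^sup>2))"
      using v h F by (intro ext) (simp add: objective_def vnorm_square_sum[of _ m])
    have D2: "((\<lambda>t. objective F (v + t \<cdot>\<^sub>v h)) has_real_derivative
        (\<Sum>i<m. F v $ i * (row (G v) i \<bullet> h))) (at 0)"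
      unfolding obj
      by (rule derivative_eq_intros comp refl | simp)+
        (simp add: v0 sum_distrib_left mult_ac)
    have "(\<Sum>i<m. F v $ i * (row (G v) i \<bullet> h)) = F v \<bullet> (G v *\<^sub>v h)"
      using A h by (auto simp: scalar_prod_def[of "F v"] atLeast0LessThan)
    also have "\<dots> = grad_vec F G v \<bullet> h"
      unfolding grad_vec_def
      using transpose_vec_mult_scalar[OF A h F[OF v]] by simp
    finally show ?thesis
      using DERIV_unique[OF D1 D2] by simp
  qed
  then have "(g - grad_vec F G v) \<bullet> (g - grad_vec F G v) = 0"
    using g gv by (simp add: minus_scalar_prod_distrib[of _ n])
  then have "g - grad_vec F G v = 0\<^sub>v n"
    using vnorm_eq_0_iff[of "g - grad_vec F G v" n] g gv by (simp add: vnorm_def)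
  then show ?thesis
    using g gv by (metis (no_types, lifting) eq_vecI carrier_vecD index_minus_vec(1) index_zero_vec(1)
        eq_iff_diff_eq_0)
qed

text \<open>
  Along the segment from \<open>v\<close> to \<open>v + s\<close> the difference between \<open>f\<close>
  and the quadratic on the right has derivative
  \<open>(grad (v + t s) - grad v) \<bullet> s - L t \<parallel>s\<parallel>\<^sup>2 \<le> 0\<close>.
\<close>

lemma lipschitz_gradient_descent:
  assumes grad: "\<And>w. w \<in> carrier_vec n \<Longrightarrow> has_gradient n f w (grad w)"
    and lip: "vlipschitz L n grad"
    and v: "v \<in> carrier_vec n" and s: "s \<in> carrier_vec n"
  shows "f (v + s) \<le> f v + grad v \<bullet> s + L / 2 * (vnorm s)\<^sup>2"
proof -
  define \<phi> where "\<phi> t = f (v + t \<cdot>\<^sub>v s) - t * (grad v \<bullet> s) - L / 2 * t\<^sup>2 * (vnorm s)\<^sup>2" for t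
  have gc: "grad w \<in> carrier_vec n" if "w \<in> carrier_vec n" for w
    using grad[OF that] by (simp add: has_gradient_def)
  have "\<phi> 1 \<le> \<phi> 0"
  proof (rule DERIV_nonpos_imp_nonincreasing[where a = 0 and b = 1 and f = \<phi>])
    show "(0::real) \<le> 1"
      by simp
    fix t :: real
    assume t: "0 \<le> t" "t \<le> 1"
    let ?w = "v + t \<cdot>\<^sub>v s"
    have w: "?w \<in> carrier_vec n"
      using v s by simp
    have "(\<phi> has_real_derivative (grad ?w \<bullet> s - grad v \<bullet> s - L * t * (vnorm s)\<^sup>2)) (at t)"
      unfolding \<phi>_def
      by (rule derivative_eq_intros has_gradient_ray_derivative[OF grad[OF w] v s] refl | simp)+
    moreover have "grad ?w \<bullet> s - grad v \<bullet> s \<le> L * t * (vnorm s)\<^sup>2"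
    proof -
      have "grad ?w \<bullet> s - grad v \<bullet> s = (grad ?w - grad v) \<bullet> s"
        using gc[OF w] gc[OF v] s by (simp add: minus_scalar_prod_distrib[of _ n])
      also have "\<dots> \<le> vnorm (grad ?w - grad v) * vnorm s"
        using vnorm_Cauchy_Schwarz[of "grad ?w - grad v" n s] gc[OF w] gc[OF v] s by auto
      also have "\<dots> \<le> L * vnorm (?w - v) * vnorm s"
        using lip v w by (intro mult_right_mono) (auto simp: vlipschitz_def)
      also have "?w - v = t \<cdot>\<^sub>v s"
        using v s by (intro eq_vecI) auto
      finally show ?thesis
        using t by (simp add: vnorm_smult power2_eq_square mult_ac)
    qed
    ultimately show "\<exists>y. (\<phi> has_real_derivative y) (at t) \<and> y \<le> 0"
      by fastforce
  qed
  moreover have "v + 1 \<cdot>\<^sub>v s = v + s" "v + 0 \<cdot>\<^sub>v s = v"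
    using v s by (auto intro!: eq_vecI)
  ultimately show ?thesis
    by (simp add: \<phi>_def)
qed

section \<open>One exact step on the regularized model\<close>

lemma reg_model_along_ray:
  assumes B: "B \<in> carrier_mat n n" and x: "x \<in> carrier_vec n"
    and g: "grad_vec F G v \<in> carrier_vec n"
  shows "reg_model n F G v B \<gamma> (t \<cdot>\<^sub>v x) = reg_model n F G v B \<gamma> (0\<^sub>v n)
    + t * (grad_vec F G v \<bullet> x) + t\<^sup>2 / 2 * (x \<bullet> (B *\<^sub>v x) + \<gamma> * (vnorm x)\<^sup>2)"
proof -
  have model: "reg_model n F G v B \<gamma> y = 1 / 2 * (vnorm (F v))\<^sup>2 + grad_vec F G v \<bullet> y
      + 1 / 2 * (y \<bullet> (B *\<^sub>v y) + \<gamma> * (y \<bullet> y))"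
    if y: "y \<in> carrier_vec n" for y
  proof -
    have "(\<gamma> \<cdot>\<^sub>m 1\<^sub>m n) *\<^sub>v y = \<gamma> \<cdot>\<^sub>v y"
      using y by (intro eq_vecI) auto
    then show ?thesis
      using B y unfolding reg_model_def
      by (simp add: add_mult_distrib_mat_vec[of _ n n] scalar_prod_add_distrib[of _ n])
  qed
  have zero: "B *\<^sub>v 0\<^sub>v n = 0\<^sub>v n"
    using B by (intro eq_vecI) auto
  have scaled: "(t \<cdot>\<^sub>v x) \<bullet> (B *\<^sub>v (t \<cdot>\<^sub>v x)) = t\<^sup>2 * (x \<bullet> (B *\<^sub>v x))"
    "(t \<cdot>\<^sub>v x) \<bullet> (t \<cdot>\<^sub>v x) = t\<^sup>2 * (x \<bullet> x)" "grad_vec F G v \<bullet> (t \<cdot>\<^sub>v x) = t * (grad_vec F G v \<bullet> x)"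
    using B x g by (simp_all add: mult_mat_vec[OF B x] power2_eq_square)
  have "t \<cdot>\<^sub>v x \<in> carrier_vec n"
    using x by simp
  then show ?thesis
    unfolding model[OF \<open>t \<cdot>\<^sub>v x \<in> carrier_vec n\<close>] model[OF zero_carrier_vec] scaled vnorm_square zero
    using g by (simp add: field_simps)
qed

text \<open>
  A step that is optimal among its own multiples, where \<open>b\<close> is the linear and \<open>q\<close> the quadratic
  coefficient of the model along it, makes the derivative at \<open>t = 1\<close> vanish.
\<close>

lemma scaling_stationary:
  fixes b q :: real
  assumes q: "0 \<le> q" and opt: "\<And>t. b + q / 2 \<le> t * b + t\<^sup>2 / 2 * q"
  shows "b + q = 0"
proof (rule ccontr)
  assume nz: "b + q \<noteq> 0"
  define d where "d = b + q"
  \<comment> \<open>Minimizing in \<open>e\<close> would divide by \<open>q\<close>; dividing by \<open>q + 1\<close> also covers \<open>q = 0\<close>.\<close>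
  define e where "e = - d / (q + 1)"
  have q1: "0 < q + 1"
    using q by simp
  have "0 \<le> e * d + e\<^sup>2 * q / 2"
    using opt[of "1 + e"] by (simp add: d_def power2_eq_square algebra_simps add_divide_distrib)
  also have "e * d = - (e\<^sup>2 * (q + 1))"
    using q1 by (simp add: e_def power2_eq_square)
  finally have "e\<^sup>2 * (q / 2 + 1) \<le> 0"
    by (simp add: algebra_simps)
  moreover have "0 < e\<^sup>2"
    using nz q1 by (simp add: e_def d_def)
  ultimately show False
    using q by (smt (verit) mult_pos_pos divide_nonneg_nonneg)
qed

text \<open>
  The exact step competes with two families of steps: its own multiples give the
  stationarity \<open>g \<bullet> s = - s \<bullet> (H + \<gamma> I) s\<close>, and the steepest descent step of length
  \<open>\<parallel>g\<parallel> / (M + \<gamma>)\<close> gives the lower bound on the predicted decrease.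
\<close>

lemma exact_step_predicted_decrease:
  assumes B: "B \<in> carrier_mat n n" and psd: "pos_semidef n B" and M: "spectral_norm B \<le> M" "0 < M"
    and \<gamma>: "0 < \<gamma>" and g: "grad_vec F G v \<in> carrier_vec n"
    and opt: "is_arg_min (reg_model n F G v B \<gamma>) (\<lambda>x. x \<in> carrier_vec n) x"
  defines "D \<equiv> reg_model n F G v B \<gamma> (0\<^sub>v n) - reg_model n F G v B \<gamma> x"
  shows "grad_vec F G v \<bullet> x = - 2 * D"
    and "\<gamma> / 2 * (vnorm x)\<^sup>2 \<le> D"
    and "(vnorm (grad_vec F G v))\<^sup>2 / (2 * (M + \<gamma>)) \<le> D"
proof -
  let ?g = "grad_vec F G v"
  let ?q = "\<lambda>x. x \<bullet> (B *\<^sub>v x) + \<gamma> * (vnorm x)\<^sup>2"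
  have x: "x \<in> carrier_vec n"
    and le: "\<And>w. w \<in> carrier_vec n \<Longrightarrow> reg_model n F G v B \<gamma> x \<le> reg_model n F G v B \<gamma> w"
    using opt by (auto simp: is_arg_min_linorder)
  have ray: "- D \<le> t * (?g \<bullet> w) + t\<^sup>2 / 2 * ?q w" if w: "w \<in> carrier_vec n" for t w
    using le[of "t \<cdot>\<^sub>v w"] w reg_model_along_ray[OF B w g, of \<gamma> t] by (simp add: D_def)
  have "1 \<cdot>\<^sub>v x = x"
    using x by (intro eq_vecI) auto
  then have mD: "- D = ?g \<bullet> x + ?q x / 2"
    using reg_model_along_ray[OF B x g, of \<gamma> 1] by (simp add: D_def)
  have xBx: "0 \<le> x \<bullet> (B *\<^sub>v x)"
    using psd x by (simp add: pos_semidef_def)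
  have stationary: "?g \<bullet> x + ?q x = 0"
    using scaling_stationary[of "?q x" "?g \<bullet> x"] ray[OF x] xBx \<gamma> by (simp add: mD)
  then have "?g \<bullet> x = - ?q x"
    by linarith
  moreover have "D = ?q x / 2"
    using mD unfolding calculation by (simp add: field_simps)
  ultimately show "?g \<bullet> x = - 2 * D" and "\<gamma> / 2 * (vnorm x)\<^sup>2 \<le> D"
    using xBx by (simp_all add: field_simps)
  have qg: "?q ?g \<le> (M + \<gamma>) * (vnorm ?g)\<^sup>2"
    using spectral_norm_quadratic_bound[OF B g] mult_right_mono[OF M(1), of "(vnorm ?g)\<^sup>2"]
    by (simp add: algebra_simps)
  define t where "t = 1 / (M + \<gamma>)"
  have Mg: "0 < M + \<gamma>"
    using M \<gamma> by simp
  have "- D \<le> - t * (vnorm ?g)\<^sup>2 + t\<^sup>2 / 2 * ?q ?g"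
    using ray[OF g, of "- t"] by (simp add: vnorm_square)
  also have "\<dots> \<le> - t * (vnorm ?g)\<^sup>2 + t\<^sup>2 / 2 * ((M + \<gamma>) * (vnorm ?g)\<^sup>2)"
    using qg by (intro add_left_mono mult_left_mono) auto
  also have "\<dots> = - ((vnorm ?g)\<^sup>2 / (2 * (M + \<gamma>)))"
  proof -
    have "t\<^sup>2 / 2 * ((M + \<gamma>) * (vnorm ?g)\<^sup>2) = t / 2 * (vnorm ?g)\<^sup>2"
      using Mg by (simp add: t_def power2_eq_square)
    moreover have "(vnorm ?g)\<^sup>2 / (2 * (M + \<gamma>)) = t / 2 * (vnorm ?g)\<^sup>2"
      by (simp add: t_def)
    ultimately show ?thesis
      by (simp only:)
  qed
  finally show "(vnorm ?g)\<^sup>2 / (2 * (M + \<gamma>)) \<le> D"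
    by simp
qed

section \<open>Counting iterations of a decreasing sequence\<close>

text \<open>
  If \<open>k\<close> is a contracting index and \<open>N\<close> of them precede it, then
  \<open>\<theta> < J k \<le> exp (- \<delta> N) D\<close>, which bounds \<open>N\<close>; the summand 1 stands for \<open>k\<close> itself.
\<close>

lemma card_contractions_le:
  fixes J :: "nat \<Rightarrow> real"
  assumes \<delta>: "0 < \<delta>" and \<theta>: "0 < \<theta>" and D: "J 0 \<le> D" "\<theta> \<le> D"
    and nonneg: "\<And>k. 0 \<le> J k" and decr: "\<And>k. J (Suc k) \<le> J k"
    and contr: "\<And>k. k \<in> S \<Longrightarrow> J (Suc k) \<le> (1 - \<delta>) * J k"
    and above: "\<And>k. k \<in> S \<Longrightarrow> \<theta> < J k"
  shows "finite S \<and> real (card S) \<le> 1 + ln (D / \<theta>) / \<delta>"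
proof -
  define N where "N k = card (S \<inter> {..<k})" for k
  have N_Suc: "N (Suc k) = (if k \<in> S then Suc (N k) else N k)" for k
    by (auto simp: N_def lessThan_Suc Int_insert_right)
  have bound: "J k \<le> exp (- \<delta> * real (N k)) * D" for k
  proof (induction k)
    case 0
    then show ?case
      using D by (simp add: N_def)
  next
    case (Suc k)
    show ?case
    proof (cases "k \<in> S")
      case True
      have "J (Suc k) \<le> (1 - \<delta>) * J k"
        by (rule contr[OF True])
      also have "\<dots> \<le> exp (- \<delta>) * J k"
        using exp_ge_add_one_self[of "- \<delta>"] nonneg by (intro mult_right_mono) auto
      also have "\<dots> \<le> exp (- \<delta>) * (exp (- \<delta> * real (N k)) * D)"
        using Suc by simp
      also have "\<dots> = exp (- \<delta> * real (N (Suc k))) * D"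
        using True by (simp add: N_Suc exp_add[symmetric] algebra_simps flip: mult.assoc)
      finally show ?thesis .
    next
      case False
      then show ?thesis
        using Suc decr[of k] by (simp add: N_Suc)
    qed
  qed
  have Dpos: "0 < D"
    using D \<theta> by simp
  have N_le: "real (N k) \<le> ln (D / \<theta>) / \<delta>" if "k \<in> S" for k
  proof -
    have "\<theta> \<le> exp (- \<delta> * real (N k)) * D"
      using above[OF that] bound[of k] by simp
    then have "exp (\<delta> * real (N k)) \<le> D / \<theta>"
      using \<theta> by (simp add: exp_minus field_simps)
    then have "\<delta> * real (N k) \<le> ln (D / \<theta>)"
      using Dpos \<theta> by (simp add: ln_ge_iff)
    then show ?thesis
      using \<delta> by (simp add: field_simps)
  qed
  have ln0: "0 \<le> ln (D / \<theta>) / \<delta>"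
    using D \<theta> \<delta> by (intro divide_nonneg_pos ln_ge_zero) auto
  have card_le: "real (card T) \<le> 1 + ln (D / \<theta>) / \<delta>" if T: "T \<subseteq> S" "finite T" for T
  proof (cases "T = {}")
    case True
    then show ?thesis
      using ln0 by simp
  next
    case False
    then have M: "Max T \<in> T"
      using T by simp
    have "T \<subseteq> insert (Max T) (S \<inter> {..<Max T})"
      using T Max_ge[OF T(2)] by (auto simp: le_less)
    then have "card T \<le> card (insert (Max T) (S \<inter> {..<Max T}))"
      by (rule card_mono[rotated]) simp
    also have "\<dots> \<le> Suc (N (Max T))"
      by (simp add: N_def card_insert_le_m1)
    finally show ?thesis
      using N_le[of "Max T"] M T by fastforce
  qed
  have "finite S \<and> card S \<le> nat \<lfloor>1 + ln (D / \<theta>) / \<delta>\<rfloor>"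
    using card_le by (intro finite_if_finite_subsets_card_bdd le_nat_floor)
  then show ?thesis
    using card_le by blast
qed

text \<open>
  A run of unsuccessful indices keeps doubling \<open>\<gamma>\<close> from a value of at least \<open>\<gamma>min\<close>, and
  cannot continue once \<open>\<gamma> \<ge> L\<close>.  So it has length at most \<open>Q\<close> and ends at an index of
  \<open>S\<close>; each element of \<open>U\<close> lies within distance \<open>Q\<close> before one of \<open>S\<close>.
\<close>

lemma card_doublings_le:
  fixes \<gamma> :: "nat \<Rightarrow> real"
  assumes S: "finite S" and low: "\<And>k. \<gamma>min \<le> \<gamma> k"
    and step: "\<And>k. k \<in> U \<Longrightarrow> \<gamma> (Suc k) = 2 * \<gamma> k \<and> \<gamma> k < L \<and> Suc k \<in> S \<union> U"
    and Q: "L \<le> 2 ^ Q * \<gamma>min"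
  shows "finite U \<and> card U \<le> Q * card S"
proof -
  have near: "\<exists>q\<in>{1..Q}. k + q \<in> S" if k: "k \<in> U" for k
  proof (rule ccontr)
    assume no: "\<not> (\<exists>q\<in>{1..Q}. k + q \<in> S)"
    have "k + q \<in> U \<and> \<gamma> (k + q) = 2 ^ q * \<gamma> k" if "q \<le> Q" for q
      using that
    proof (induction q)
      case 0
      then show ?case
        using k by simp
    next
      case (Suc q)
      then have "k + q \<in> U" "\<gamma> (k + q) = 2 ^ q * \<gamma> k"
        by auto
      moreover have "k + Suc q \<notin> S"
        using no Suc.prems by (metis atLeastAtMost_iff le_add1 plus_1_eq_Suc)
      ultimately show ?case
        using step[of "k + q"] by auto
    qed
    then have "k + Q \<in> U" "\<gamma> (k + Q) = 2 ^ Q * \<gamma> k"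
      by auto
    then have "2 ^ Q * \<gamma> k < L"
      using step[of "k + Q"] by simp
    moreover have "2 ^ Q * \<gamma>min \<le> 2 ^ Q * \<gamma> k"
      using low by simp
    ultimately show False
      using Q by linarith
  qed
  have sub: "U \<subseteq> (\<lambda>(q, j). j - q) ` ({1..Q} \<times> S)"
  proof
    fix k
    assume "k \<in> U"
    then obtain q where "q \<in> {1..Q}" "k + q \<in> S"
      using near by blast
    then show "k \<in> (\<lambda>(q, j). j - q) ` ({1..Q} \<times> S)"
      by (intro image_eqI[of _ _ "(q, k + q)"]) auto
  qed
  have fin: "finite ({1..Q} \<times> S)"
    using S by simp
  have "card U \<le> card ({1..Q} \<times> S)"
    using fin sub by (rule surj_card_le)
  then show ?thesis
    using finite_surj[OF fin sub] by (simp add: card_cartesian_product)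
qed

section \<open>Runs of the method with exact steps\<close>

locale exact_regularization_run =
  fixes L M \<eta> \<gamma>0 \<gamma>min :: real and n m :: nat
    and F :: "real vec \<Rightarrow> real vec" and G :: "real vec \<Rightarrow> real mat"
    and H :: "nat \<Rightarrow> real mat" and u s :: "nat \<Rightarrow> real vec" and \<gamma> :: "nat \<Rightarrow> real"
  assumes L_pos: "0 < L" and M_pos: "0 < M" and \<eta>_pos: "0 < \<eta>" and \<eta>_less_1: "\<eta> < 1"
    and \<gamma>min_pos: "0 < \<gamma>min" and \<gamma>min_le: "\<gamma>min \<le> \<gamma>0"
    and residual_carrier: "\<And>v. v \<in> carrier_vec n \<Longrightarrow> F v \<in> carrier_vec m"
    and jacobian: "\<And>v. v \<in> carrier_vec n \<Longrightarrow> has_jacobian n m F v (G v)"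
    and C1: "C1_lipschitz_gradient L n (objective F)"
    and run: "regularization_run n F G \<eta> \<gamma>0 \<gamma>min H u s \<gamma>"
    and exact: "exact_steps n F G H u s \<gamma>"
    and H_bound: "\<And>k. spectral_norm (H k) \<le> M"
    and H_psd: "\<And>k. pos_semidef n (H k)"
begin

abbreviation "J k \<equiv> objective F (u k)"
abbreviation "g k \<equiv> grad_vec F G (u k)"

definition predicted :: "nat \<Rightarrow> real" where
  "predicted k =
    reg_model n F G (u k) (H k) (\<gamma> k) (0\<^sub>v n) - reg_model n F G (u k) (H k) (\<gamma> k) (s k)"

definition \<gamma>max :: real where
  "\<gamma>max = max \<gamma>0 (2 * L)"

lemma \<gamma>_0: "\<gamma> 0 = \<gamma>0"
  using run by (simp add: regularization_run_def)

lemma s_carrier: "s k \<in> carrier_vec n"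
  using run by (simp add: regularization_run_def)

lemma H_carrier: "H k \<in> carrier_mat n n"
  using run by (simp add: regularization_run_def)

lemma stationary_step: "g k = 0\<^sub>v n \<Longrightarrow> u (Suc k) = u k"
  and stationary_\<gamma>: "g k = 0\<^sub>v n \<Longrightarrow> \<gamma> (Suc k) \<in> {max (0.5 * \<gamma> k) \<gamma>min, 2 * \<gamma> k}"
  and accepted: "g k \<noteq> 0\<^sub>v n \<Longrightarrow> \<eta> \<le> decrease_ratio n F G (u k) (H k) (\<gamma> k) (s k) \<Longrightarrow>
    u (Suc k) = u k + s k \<and> \<gamma> (Suc k) = max (0.5 * \<gamma> k) \<gamma>min"
  and rejected: "g k \<noteq> 0\<^sub>v n \<Longrightarrow> \<not> \<eta> \<le> decrease_ratio n F G (u k) (H k) (\<gamma> k) (s k) \<Longrightarrow>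
    u (Suc k) = u k \<and> \<gamma> (Suc k) = 2 * \<gamma> k"
  using run unfolding regularization_run_def by (auto split: if_splits)

lemma u_carrier: "u k \<in> carrier_vec n"
proof (induction k)
  case 0
  then show ?case
    using run by (simp add: regularization_run_def)
next
  case (Suc k)
  then show ?case
    using stationary_step[of k] accepted[of k] rejected[of k] s_carrier[of k]
    by (cases "g k = 0\<^sub>v n"; cases "\<eta> \<le> decrease_ratio n F G (u k) (H k) (\<gamma> k) (s k)") simp_all
qed

lemma g_carrier: "g k \<in> carrier_vec n"
  using jacobian[OF u_carrier[of k]] residual_carrier[OF u_carrier[of k]]
  unfolding grad_vec_def has_jacobian_def by (metis mult_mat_vec_carrier transpose_carrier_mat)

lemma \<gamma>_ge_min: "\<gamma>min \<le> \<gamma> k"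
proof (induction k)
  case 0
  then show ?case
    using \<gamma>_0 \<gamma>min_le by simp
next
  case (Suc k)
  then show ?case
    using stationary_\<gamma>[of k] accepted[of k] rejected[of k] \<gamma>min_pos
    by (cases "g k = 0\<^sub>v n"; cases "\<eta> \<le> decrease_ratio n F G (u k) (H k) (\<gamma> k) (s k)") auto
qed

lemma \<gamma>_pos: "0 < \<gamma> k"
  using \<gamma>_ge_min[of k] \<gamma>min_pos by simp

lemma J_nonneg: "0 \<le> J k"
  by (simp add: objective_def)

lemma step_descent: "objective F (u k + s k) \<le> J k + g k \<bullet> s k + L / 2 * (vnorm (s k))\<^sup>2"
proof -
  obtain grad where grad: "\<And>v. v \<in> carrier_vec n \<Longrightarrow> has_gradient n (objective F) v (grad v)"
    and lip: "vlipschitz L n grad"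
    using C1 unfolding C1_lipschitz_gradient_def by blast
  have "grad (u k) = g k"
    using objective_gradient_unique[of n F "u k" "grad (u k)" m G] grad jacobian residual_carrier
      u_carrier by simp
  then show ?thesis
    using lipschitz_gradient_descent[OF grad lip u_carrier[of k] s_carrier[of k]] by simp
qed

lemmas predicted_facts = exact_step_predicted_decrease[OF H_carrier H_psd H_bound M_pos \<gamma>_pos g_carrier
    exact[unfolded exact_steps_def, rule_format], folded predicted_def]

lemma predicted_pos: "0 < predicted k" if "g k \<noteq> 0\<^sub>v n"
proof -
  have "0 < (vnorm (g k))\<^sup>2 / (2 * (M + \<gamma> k))"
    using that vnorm_eq_0_iff[OF g_carrier] M_pos \<gamma>_pos[of k] by simp
  then show ?thesis
    using predicted_facts(3)[of k] by linarith
qed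

text \<open>
  Half of \<open>- g \<bullet> s\<close> is the predicted decrease; for \<open>\<gamma> \<ge> L\<close> the other half pays for the
  curvature term of the descent inequality, so the ratio is at least 1.
\<close>

lemma accepted_if_\<gamma>_ge_L:
  assumes "g k \<noteq> 0\<^sub>v n" and "L \<le> \<gamma> k"
  shows "\<eta> \<le> decrease_ratio n F G (u k) (H k) (\<gamma> k) (s k)"
proof -
  have "L / 2 * (vnorm (s k))\<^sup>2 \<le> \<gamma> k / 2 * (vnorm (s k))\<^sup>2"
    using assms(2) by (intro mult_right_mono) auto
  then have "predicted k \<le> J k - objective F (u k + s k)"
    using step_descent[of k] predicted_facts(1,2)[of k] by linarith
  then have "1 \<le> decrease_ratio n F G (u k) (H k) (\<gamma> k) (s k)"
    using predicted_pos[OF assms(1)] by (simp add: decrease_ratio_def flip: predicted_def)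
  then show ?thesis
    using \<eta>_less_1 by simp
qed

lemma successful_decrease:
  assumes "u (Suc k) \<noteq> u k"
  shows "g k \<noteq> 0\<^sub>v n" and "J (Suc k) \<le> J k - \<eta> * predicted k"
proof -
  show g: "g k \<noteq> 0\<^sub>v n"
    using assms stationary_step by blast
  then have acc: "\<eta> \<le> decrease_ratio n F G (u k) (H k) (\<gamma> k) (s k)"
    using assms rejected by blast
  then have "\<eta> * predicted k \<le> J k - objective F (u k + s k)"
    using predicted_pos[OF g] by (simp add: decrease_ratio_def pos_le_divide_eq flip: predicted_def)
  then show "J (Suc k) \<le> J k - \<eta> * predicted k"
    using accepted[OF g acc] by simp
qed

text \<open>
  Where \<open>g \<noteq> 0\<close> the predicted decrease is positive, so the step is nonzero.
  Hence an iterate that stays put there does so because its trial step was rejected.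
\<close>

lemma unsuccessful_doubling:
  assumes same: "u (Suc k) = u k" and g: "g k \<noteq> 0\<^sub>v n"
  shows "\<gamma> (Suc k) = 2 * \<gamma> k" and "\<gamma> k < L"
proof -
  have rej: "\<not> \<eta> \<le> decrease_ratio n F G (u k) (H k) (\<gamma> k) (s k)"
  proof
    assume acc: "\<eta> \<le> decrease_ratio n F G (u k) (H k) (\<gamma> k) (s k)"
    then have "u k = u k + s k"
      using accepted[OF g] same by simp
    then have "u k $ i = u k $ i + s k $ i" if "i < n" for i
      using that s_carrier[of k] by (metis carrier_vecD index_add_vec(1))
    then have "s k = 0\<^sub>v n"
      using s_carrier[of k] by (intro eq_vecI) auto
    then show False
      using predicted_pos[OF g] by (simp add: predicted_def)
  qed
  then show "\<gamma> (Suc k) = 2 * \<gamma> k"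
    using rejected[OF g] by simp
  show "\<gamma> k < L"
    using rej accepted_if_\<gamma>_ge_L[OF g] by fastforce
qed

lemma J_decr: "J (Suc k) \<le> J k"
proof (cases "u (Suc k) = u k")
  case False
  then show ?thesis
    using successful_decrease[OF False] mult_pos_pos[OF \<eta>_pos predicted_pos[of k]] by simp
qed simp

text \<open>
  At a stationary iterate \<open>\<gamma>\<close> may double forever, whence the hypothesis.  It passes to all
  earlier indices because the iterates no longer move once they are stationary.
\<close>

lemma \<gamma>_le_max: "g k \<noteq> 0\<^sub>v n \<Longrightarrow> \<gamma> k \<le> \<gamma>max"
proof (induction k)
  case 0
  then show ?case
    by (simp add: \<gamma>_0 \<gamma>max_def)
next
  case (Suc k)
  then have g: "g k \<noteq> 0\<^sub>v n"
    using stationary_step[of k] by auto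
  show ?case
  proof (cases "\<eta> \<le> decrease_ratio n F G (u k) (H k) (\<gamma> k) (s k)")
    case True
    have "\<gamma>min \<le> \<gamma>max"
      using \<gamma>min_le by (simp add: \<gamma>max_def)
    then show ?thesis
      using accepted[OF g True] Suc.IH[OF g] \<gamma>_pos[of k] by simp
  next
    case False
    then have "\<gamma> k < L"
      using accepted_if_\<gamma>_ge_L[OF g] by fastforce
    then show ?thesis
      using rejected[OF g False] by (simp add: \<gamma>max_def)
  qed
qed

lemma not_approx_solution_iff:
  assumes "0 < \<epsilon>R"
  shows "\<not> approx_solution F G \<epsilon>g \<epsilon>R v \<longleftrightarrow>
    \<epsilon>R < vnorm (F v) \<and> \<epsilon>g * vnorm (F v) < vnorm (grad_vec F G v)"
  using assms by (auto simp: approx_solution_def grad_vec_def not_le pos_less_divide_eq)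

lemma not_approx_g_nonzero:
  assumes "0 < \<epsilon>g" "0 < \<epsilon>R" "\<not> approx_solution F G \<epsilon>g \<epsilon>R (u k)"
  shows "g k \<noteq> 0\<^sub>v n"
proof
  assume "g k = 0\<^sub>v n"
  then have "vnorm (g k) = 0"
    by (simp add: vnorm_def)
  then show False
    using assms(3) assms(1) vnorm_nonneg[of "F (u k)"]
    unfolding not_approx_solution_iff[OF assms(2)] by (simp add: mult_less_0_iff)
qed

text \<open>
  The gradient is large relative to the residual, so the decrease guaranteed by the
  acceptance test is a fixed fraction of the objective itself; this is why the residual tolerance
  enters the count only through a logarithm.
\<close>

lemma successful_contraction:
  assumes \<epsilon>: "0 < \<epsilon>g" "0 < \<epsilon>R" and na: "\<not> approx_solution F G \<epsilon>g \<epsilon>R (u k)"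
    and succ: "u (Suc k) \<noteq> u k"
  shows "J (Suc k) \<le> (1 - \<eta> / (M + \<gamma>max) * \<epsilon>g\<^sup>2) * J k"
proof -
  have le: "\<gamma> k \<le> \<gamma>max"
    using \<gamma>_le_max not_approx_g_nonzero[OF \<epsilon> na] by simp
  have pos: "0 < M + \<gamma> k"
    using M_pos \<gamma>_pos[of k] by simp
  have "(\<epsilon>g * vnorm (F (u k)))\<^sup>2 \<le> (vnorm (g k))\<^sup>2"
    using na \<epsilon> unfolding not_approx_solution_iff[OF \<epsilon>(2)] by (intro power_mono) auto
  then have "\<epsilon>g\<^sup>2 * (vnorm (F (u k)))\<^sup>2 / (2 * (M + \<gamma>max)) \<le> (vnorm (g k))\<^sup>2 / (2 * (M + \<gamma> k))"
    using le pos by (intro frac_le) (auto simp: power_mult_distrib)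
  also have "\<dots> \<le> predicted k"
    by (rule predicted_facts(3))
  finally have "\<eta> * (\<epsilon>g\<^sup>2 * (vnorm (F (u k)))\<^sup>2 / (2 * (M + \<gamma>max))) \<le> \<eta> * predicted k"
    using \<eta>_pos by (intro mult_left_mono) auto
  moreover have "\<eta> * (\<epsilon>g\<^sup>2 * (vnorm (F (u k)))\<^sup>2 / (2 * (M + \<gamma>max))) = \<eta> / (M + \<gamma>max) * \<epsilon>g\<^sup>2 * J k"
    by (simp add: objective_def algebra_simps)
  ultimately show ?thesis
    using successful_decrease(2)[OF succ] by (simp add: algebra_simps)
qed

lemma iteration_counts:
  assumes \<epsilon>: "0 < \<epsilon>g" "0 < \<epsilon>R" and D: "J 0 \<le> D" "\<epsilon>R\<^sup>2 / 2 \<le> D"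
    and Q: "L \<le> 2 ^ Q * \<gamma>min"
  shows "finite (succ_iters F G u \<epsilon>g \<epsilon>R)"
    and "real (card (succ_iters F G u \<epsilon>g \<epsilon>R))
      \<le> 1 + ln (D / (\<epsilon>R\<^sup>2 / 2)) / (\<eta> / (M + \<gamma>max) * \<epsilon>g\<^sup>2)"
    and "finite (unsucc_iters F G u \<epsilon>g \<epsilon>R)"
    and "card (unsucc_iters F G u \<epsilon>g \<epsilon>R) \<le> Q * card (succ_iters F G u \<epsilon>g \<epsilon>R)"
proof -
  let ?S = "succ_iters F G u \<epsilon>g \<epsilon>R" and ?U = "unsucc_iters F G u \<epsilon>g \<epsilon>R"
  have \<gamma>max_pos: "0 < \<gamma>max"
    using L_pos by (simp add: \<gamma>max_def less_max_iff_disj)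
  have S: "finite ?S \<and> real (card ?S) \<le> 1 + ln (D / (\<epsilon>R\<^sup>2 / 2)) / (\<eta> / (M + \<gamma>max) * \<epsilon>g\<^sup>2)"
  proof (rule card_contractions_le[where J = J])
    show "0 < \<eta> / (M + \<gamma>max) * \<epsilon>g\<^sup>2"
      using \<eta>_pos M_pos \<gamma>max_pos \<epsilon> by simp
    show "J (Suc k) \<le> (1 - \<eta> / (M + \<gamma>max) * \<epsilon>g\<^sup>2) * J k" if "k \<in> ?S" for k
      using that successful_contraction[OF \<epsilon>] by (simp add: succ_iters_def)
    show "\<epsilon>R\<^sup>2 / 2 < J k" if "k \<in> ?S" for k
    proof -
      have "\<epsilon>R < vnorm (F (u k))"
        using that \<epsilon> by (simp add: succ_iters_def not_approx_solution_iff)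
      then have "\<epsilon>R\<^sup>2 < (vnorm (F (u k)))\<^sup>2"
        using \<epsilon> by (intro power_strict_mono) auto
      then show ?thesis
        by (simp add: objective_def)
    qed
  qed (use \<epsilon> D J_nonneg J_decr in auto)
  have U: "finite ?U \<and> card ?U \<le> Q * card ?S"
  proof (rule card_doublings_le[where \<gamma> = \<gamma> and L = L and \<gamma>min = \<gamma>min])
    show "\<gamma> (Suc k) = 2 * \<gamma> k \<and> \<gamma> k < L \<and> Suc k \<in> ?S \<union> ?U" if k: "k \<in> ?U" for k
    proof -
      have same: "u (Suc k) = u k" and na: "\<not> approx_solution F G \<epsilon>g \<epsilon>R (u k)"
        using k by (auto simp: unsucc_iters_def)
      have "Suc k \<in> ?S \<union> ?U"
        using na same by (auto simp: succ_iters_def unsucc_iters_def)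
      then show ?thesis
        using unsuccessful_doubling[OF same not_approx_g_nonzero[OF \<epsilon> na]] by simp
    qed
  qed (use S \<gamma>_ge_min Q in auto)
  show "finite ?S" "real (card ?S) \<le> 1 + ln (D / (\<epsilon>R\<^sup>2 / 2)) / (\<eta> / (M + \<gamma>max) * \<epsilon>g\<^sup>2)"
    "finite ?U" "card ?U \<le> Q * card ?S"
    using S U by auto
qed

end

lemma reduced_residual_carrier:
  assumes P: "implicit_problem ny n m p R c" and v: "v \<in> carrier_vec n"
  shows "reduced_residual ny p R c v \<in> carrier_vec m"
proof -
  have "\<exists>!y. y \<in> carrier_vec ny \<and> c y v = 0\<^sub>v p"
    using P v by (simp add: implicit_problem_def)
  then have "implicit_sol ny p c v \<in> carrier_vec ny"
    using theI'[of "\<lambda>y. y \<in> carrier_vec ny \<and> c y v = 0\<^sub>v p"] by (simp add: implicit_sol_def)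
  then show ?thesis
    using P v by (simp add: reduced_residual_def implicit_problem_def)
qed

text \<open>
  For \<open>\<epsilon>R \<le> exp (- 1)\<close> the quantity \<open>ln (1 / \<epsilon>R) / \<epsilon>g\<^sup>2\<close> is at least 1, so it absorbs
  additive constants.
\<close>

lemma log_bound_absorbs_constants:
  fixes \<epsilon>g \<epsilon>R \<kappa> D :: real
  assumes \<epsilon>: "0 < \<epsilon>g" "\<epsilon>g < 1" "0 < \<epsilon>R" "\<epsilon>R \<le> exp (- 1)" and \<kappa>: "0 < \<kappa>" and D: "1 / 2 \<le> D"
  defines "X \<equiv> ln (1 / \<epsilon>R) * (1 / \<epsilon>g\<^sup>2)"
  shows "1 \<le> X"
    and "1 + ln (D / (\<epsilon>R\<^sup>2 / 2)) / (\<kappa> * \<epsilon>g\<^sup>2) \<le> (1 + (ln (2 * D) + 2) / \<kappa>) * X"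
proof -
  define l where "l = ln (1 / \<epsilon>R)"
  have "ln \<epsilon>R \<le> - 1"
    using \<epsilon> ln_le_cancel_iff[of \<epsilon>R "exp (- 1)"] by simp
  then have l: "1 \<le> l"
    using \<epsilon> by (simp add: l_def ln_div)
  have g2: "0 < \<epsilon>g\<^sup>2" "\<epsilon>g\<^sup>2 \<le> 1"
    using \<epsilon> by (auto simp: power_le_one)
  have "l \<le> X"
    using g2 l by (simp add: X_def l_def[symmetric] pos_le_divide_eq mult_left_le)
  then show X1: "1 \<le> X"
    using l by simp
  have lnD: "0 \<le> ln (2 * D)"
    using D by (intro ln_ge_zero) simp
  have "D / (\<epsilon>R\<^sup>2 / 2) = 2 * D * (1 / \<epsilon>R)\<^sup>2"
    by (simp add: power_one_over field_simps)
  then have "ln (D / (\<epsilon>R\<^sup>2 / 2)) = ln (2 * D) + 2 * l"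
    using D \<epsilon> by (simp add: l_def ln_mult ln_realpow)
  also have "\<dots> \<le> (ln (2 * D) + 2) * l"
    using mult_left_mono[OF l lnD] by (simp add: algebra_simps)
  finally have "ln (D / (\<epsilon>R\<^sup>2 / 2)) / (\<kappa> * \<epsilon>g\<^sup>2) \<le> (ln (2 * D) + 2) * l / (\<kappa> * \<epsilon>g\<^sup>2)"
    using \<kappa> g2 by (intro divide_right_mono) auto
  also have "\<dots> = (ln (2 * D) + 2) / \<kappa> * X"
    by (simp add: X_def l_def)
  finally show "1 + ln (D / (\<epsilon>R\<^sup>2 / 2)) / (\<kappa> * \<epsilon>g\<^sup>2) \<le> (1 + (ln (2 * D) + 2) / \<kappa>) * X"
    using X1 by (simp add: algebra_simps)
qed

theorem theorem3p1:
  fixes L M_H \<eta> \<gamma>0 \<gamma>min J0 :: real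
  assumes "0 < L" and "0 < M_H" and "0 < \<eta>" and "\<eta> < 1"
    and "0 < \<gamma>0" and "0 < \<gamma>min" and "\<gamma>min \<le> \<gamma>0"
  shows "\<exists>C \<epsilon>bar :: real. 0 < C \<and> 0 < \<epsilon>bar \<and> \<epsilon>bar < 1 \<and>
    (\<forall>(ny::nat) (n::nat) (m::nat) (p::nat)
       (R :: real vec \<Rightarrow> real vec \<Rightarrow> real vec) (c :: real vec \<Rightarrow> real vec \<Rightarrow> real vec)
       (Rh :: real vec \<Rightarrow> real vec) (G :: real vec \<Rightarrow> real mat)
       (H :: nat \<Rightarrow> real mat) (u :: nat \<Rightarrow> real vec) (s :: nat \<Rightarrow> real vec) (\<gamma> :: nat \<Rightarrow> real).
       implicit_problem ny n m p R c \<longrightarrow>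
       Rh = reduced_residual ny p R c \<longrightarrow>
       (\<forall>v \<in> carrier_vec n. has_jacobian n m Rh v (G v)) \<longrightarrow>
       C1_lipschitz_gradient L n (objective Rh) \<longrightarrow>
       regularization_run n Rh G \<eta> \<gamma>0 \<gamma>min H u s \<gamma> \<longrightarrow>
       exact_steps n Rh G H u s \<gamma> \<longrightarrow>
       (\<forall>k. spectral_norm (H k) \<le> M_H) \<longrightarrow>
       (\<forall>k. pos_semidef n (H k)) \<longrightarrow>
       objective Rh (u 0) = J0 \<longrightarrow>
       (\<forall>\<epsilon>g \<epsilon>R :: real. 0 < \<epsilon>g \<and> \<epsilon>g < 1 \<and> 0 < \<epsilon>R \<and> \<epsilon>R \<le> \<epsilon>bar \<longrightarrow>
          finite (succ_iters Rh G u \<epsilon>g \<epsilon>R) \<and>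
          finite (unsucc_iters Rh G u \<epsilon>g \<epsilon>R) \<and>
          real (card (succ_iters Rh G u \<epsilon>g \<epsilon>R)) \<le> C * ln (1 / \<epsilon>R) * (1 / \<epsilon>g\<^sup>2) \<and>
          real (jacobian_evals Rh G u \<epsilon>g \<epsilon>R) \<le> C * ln (1 / \<epsilon>R) * (1 / \<epsilon>g\<^sup>2) \<and>
          real (card (succ_iters Rh G u \<epsilon>g \<epsilon>R) + card (unsucc_iters Rh G u \<epsilon>g \<epsilon>R))
            \<le> C * ln (1 / \<epsilon>R) * (1 / \<epsilon>g\<^sup>2) \<and>
          real (residual_evals Rh G u \<epsilon>g \<epsilon>R) \<le> C * ln (1 / \<epsilon>R) * (1 / \<epsilon>g\<^sup>2)))"
proof -
  define \<kappa> where "\<kappa> = \<eta> / (M_H + max \<gamma>0 (2 * L))"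
  \<comment> \<open>The lower bound \<open>1 / 2\<close> keeps \<open>ln (2 * D)\<close> nonnegative, also for small \<open>J0\<close>.\<close>
  define D where "D = max (1 / 2) J0"
  define K where "K = 1 + (ln (2 * D) + 2) / \<kappa>"
  obtain Q :: nat where "L / \<gamma>min < 2 ^ Q"
    using real_arch_pow[of 2 "L / \<gamma>min"] by auto
  then have Q: "L \<le> 2 ^ Q * \<gamma>min"
    using \<open>0 < \<gamma>min\<close> by (simp add: pos_divide_less_eq)
  have \<kappa>: "0 < \<kappa>"
    using assms by (simp add: \<kappa>_def add_pos_pos less_max_iff_disj)
  have D: "1 / 2 \<le> D" "J0 \<le> D"
    by (auto simp: D_def)
  have "0 \<le> ln (2 * D)"
    using D by (intro ln_ge_zero) simp
  then have K: "0 < K"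
    using \<kappa> by (simp add: K_def add_pos_nonneg)
  \<comment> \<open>\<open>K\<close> bounds the successes, \<open>Q * K\<close> the unsuccessful iterations, and 1 the evaluation at \<open>u 0\<close>.\<close>
  define C where "C = 1 + (real Q + 1) * K"
  have C: "0 < C"
    using K by (simp add: C_def add_pos_nonneg)
  have main: "finite (succ_iters Rh G u \<epsilon>g \<epsilon>R) \<and> finite (unsucc_iters Rh G u \<epsilon>g \<epsilon>R) \<and>
      real (card (succ_iters Rh G u \<epsilon>g \<epsilon>R)) \<le> C * ln (1 / \<epsilon>R) * (1 / \<epsilon>g\<^sup>2) \<and>
      real (jacobian_evals Rh G u \<epsilon>g \<epsilon>R) \<le> C * ln (1 / \<epsilon>R) * (1 / \<epsilon>g\<^sup>2) \<and>
      real (card (succ_iters Rh G u \<epsilon>g \<epsilon>R) + card (unsucc_iters Rh G u \<epsilon>g \<epsilon>R))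
        \<le> C * ln (1 / \<epsilon>R) * (1 / \<epsilon>g\<^sup>2) \<and>
      real (residual_evals Rh G u \<epsilon>g \<epsilon>R) \<le> C * ln (1 / \<epsilon>R) * (1 / \<epsilon>g\<^sup>2)"
    if P: "implicit_problem ny n m p R c" and Rh: "Rh = reduced_residual ny p R c"
      and jac: "\<forall>v \<in> carrier_vec n. has_jacobian n m Rh v (G v)"
      and C1: "C1_lipschitz_gradient L n (objective Rh)"
      and run: "regularization_run n Rh G \<eta> \<gamma>0 \<gamma>min H u s \<gamma>"
      and exact: "exact_steps n Rh G H u s \<gamma>"
      and bound: "\<forall>k. spectral_norm (H k) \<le> M_H" and psd: "\<forall>k. pos_semidef n (H k)"
      and J0: "objective Rh (u 0) = J0"
      and \<epsilon>: "0 < \<epsilon>g \<and> \<epsilon>g < 1 \<and> 0 < \<epsilon>R \<and> \<epsilon>R \<le> exp (- 1)"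
    for ny n m p R c Rh G H u s \<gamma> \<epsilon>g \<epsilon>R
  proof -
    interpret exact_regularization_run L M_H \<eta> \<gamma>0 \<gamma>min n m Rh G H u s \<gamma>
      using assms jac C1 run exact bound psd reduced_residual_carrier[OF P, folded Rh]
      by unfold_locales simp_all
    define X where "X = ln (1 / \<epsilon>R) * (1 / \<epsilon>g\<^sup>2)"
    let ?S = "card (succ_iters Rh G u \<epsilon>g \<epsilon>R)" and ?U = "card (unsucc_iters Rh G u \<epsilon>g \<epsilon>R)"
    have "\<epsilon>R \<le> 1"
      using \<epsilon> order_trans[of \<epsilon>R "exp (- 1)" 1] by simp
    then have "\<epsilon>R\<^sup>2 / 2 \<le> D"
      using \<epsilon> D power_le_one[of \<epsilon>R 2] by simp
    then have counts: "finite (succ_iters Rh G u \<epsilon>g \<epsilon>R)" "finite (unsucc_iters Rh G u \<epsilon>g \<epsilon>R)"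
      "real ?S \<le> 1 + ln (D / (\<epsilon>R\<^sup>2 / 2)) / (\<kappa> * \<epsilon>g\<^sup>2)" "?U \<le> Q * ?S"
      using iteration_counts[of \<epsilon>g \<epsilon>R D Q] \<epsilon> D J0 Q by (simp_all add: \<kappa>_def \<gamma>max_def)
    have X: "1 \<le> X" and "1 + ln (D / (\<epsilon>R\<^sup>2 / 2)) / (\<kappa> * \<epsilon>g\<^sup>2) \<le> K * X"
      using log_bound_absorbs_constants[of \<epsilon>g \<epsilon>R \<kappa> D] \<epsilon> \<kappa> D by (simp_all add: X_def K_def)
    then have S: "real ?S \<le> K * X"
      using counts(3) by linarith
    have "real ?U \<le> real Q * real ?S"
      using counts(4) by (metis of_nat_le_iff of_nat_mult)
    also have "\<dots> \<le> real Q * (K * X)"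
      using S by (simp add: mult_left_mono)
    finally have "1 + (real ?S + real ?U) \<le> C * X"
      using S X by (simp add: C_def algebra_simps)
    then have total: "1 + (real ?S + real ?U) \<le> C * ln (1 / \<epsilon>R) * (1 / \<epsilon>g\<^sup>2)"
      by (simp add: X_def mult.assoc)
    show ?thesis
      using counts(1,2) total by (simp add: jacobian_evals_def residual_evals_def)
  qed
  show ?thesis
    by (rule exI[of _ C], rule exI[of _ "exp (- 1)"], rule conjI[OF C], rule conjI, simp,
        rule conjI, simp, intro allI impI, rule main; assumption)
qed

end
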